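(* Let $\mathcal{A}$ be a finite dimensional $C^*$-algebra and let $\tau : \mathcal{A} \to \mathcal{A}$ be a unital completely positive map whose spectrum (as a linear operator on $\mathcal{A}$) is contained in the unit circle $\{z \in \mathbb{C} : |z| = 1\}$. Then $\tau$ is a $*$-automorphism of $\mathcal{A}$. *)

theory Defs
  imports Complex_Main "Jordan_Normal_Form.Matrix"
begin

class scaleC =
  fixes scaleC :: "complex \<Rightarrow> 'a \<Rightarrow> 'a"  (infixr \<open>*\<^sub>C\<close> 75)

class complex_vector = scaleC + real_vector +
  assumes scaleC_add_right: "c *\<^sub>C (x + y) = c *\<^sub>C x + c *\<^sub>C y"
    and scaleC_add_left: "(c + d) *\<^sub>C x = c *\<^sub>C x + d *\<^sub>C x"
    and scaleC_scaleC: "c *\<^sub>C d *\<^sub>C x = (c * d) *\<^sub>C x"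
    and scaleC_one: "1 *\<^sub>C x = x"
    and scaleR_scaleC: "r *\<^sub>R x = complex_of_real r *\<^sub>C x"

global_interpretation complex_vector:
  vector_space "scaleC :: complex \<Rightarrow> 'a \<Rightarrow> 'a::complex_vector"
  by unfold_locales
    (simp_all add: scaleC_add_right scaleC_add_left scaleC_scaleC scaleC_one)

text \<open>
  Complex C*-algebras, with the whole type as carrier. No unit is assumed, and the
  zero algebra is admitted (unlike in \<^class>\<open>real_normed_algebra_1\<close>).
  Submultiplicativity of the norm and completeness come from \<^class>\<open>real_normed_algebra\<close>
  and \<^class>\<open>banach\<close>.
\<close>

class cstar_algebra = complex_vector + real_normed_algebra + banach +
  fixes star :: "'a \<Rightarrow> 'a"
  assumes mult_scaleC_left: "(c *\<^sub>C x) * y = c *\<^sub>C (x * y)"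
    and mult_scaleC_right: "x * (c *\<^sub>C y) = c *\<^sub>C (x * y)"
    and norm_scaleC: "norm (c *\<^sub>C x) = cmod c * norm x"
    and star_star: "star (star x) = x"
    and star_add: "star (x + y) = star x + star y"
    and star_scaleC: "star (c *\<^sub>C x) = cnj c *\<^sub>C star x"
    and star_mult: "star (x * y) = star y * star x"
    and cstar_identity: "norm (star x * x) = (norm x)\<^sup>2"

definition finite_dimensional :: "'a::complex_vector itself \<Rightarrow> bool" where
  "finite_dimensional _ \<longleftrightarrow>
    (\<exists>B :: 'a set. finite B \<and> complex_vector.span B = UNIV)"

definition is_identity :: "'a::cstar_algebra \<Rightarrow> bool" where
  "is_identity e \<longleftrightarrow> (\<forall>x. e * x = x \<and> x * e = x)"

definition unital_map :: "('a::cstar_algebra \<Rightarrow> 'b::cstar_algebra) \<Rightarrow> bool" where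
  "unital_map \<tau> \<longleftrightarrow> (\<exists>e. is_identity e \<and> is_identity (\<tau> e))"

definition star_mat :: "'a::cstar_algebra mat \<Rightarrow> 'a mat" where
  "star_mat X = map_mat star (transpose_mat X)"

text \<open>
  Positivity in the C*-algebra of n by n matrices over \<open>'a\<close>, in the form
  \<open>P = Y\<^sup>* Y\<close>; this needs only the *-algebra structure, not the C*-norm, of the
  matrix algebra.
\<close>

definition positive_mat :: "nat \<Rightarrow> 'a::cstar_algebra mat \<Rightarrow> bool" where
  "positive_mat n P \<longleftrightarrow> (\<exists>Y \<in> carrier_mat n n. P = star_mat Y * Y)"

definition completely_positive :: "('a::cstar_algebra \<Rightarrow> 'b::cstar_algebra) \<Rightarrow> bool" where
  "completely_positive \<tau> \<longleftrightarrow> Vector_Spaces.linear scaleC scaleC \<tau> \<and>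
    (\<forall>n P. positive_mat n P \<longrightarrow> positive_mat n (map_mat \<tau> P))"

definition op_spectrum :: "('a::complex_vector \<Rightarrow> 'a) \<Rightarrow> complex set" where
  "op_spectrum T = {z. \<not> bij (\<lambda>x. T x - z *\<^sub>C x)}"

definition star_automorphism :: "('a::cstar_algebra \<Rightarrow> 'a) \<Rightarrow> bool" where
  "star_automorphism \<tau> \<longleftrightarrow> Vector_Spaces.linear scaleC scaleC \<tau> \<and> bij \<tau> \<and>
    (\<forall>x y. \<tau> (x * y) = \<tau> x * \<tau> y) \<and> (\<forall>x. \<tau> (star x) = star (\<tau> x))"

end

theory Submission
  imports Defs "HOL-Analysis.Elementary_Metric_Spaces"
    "HOL-Computational_Algebra.Fundamental_Theorem_Algebra"
begin

text \<open>
  Two-positivity yields the Schwarz inequality \<open>\<tau> x\<^sup>* \<tau> x \<le> \<tau> (x\<^sup>* x)\<close>, where \<open>a \<le> b\<close> means that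
  \<open>b - a\<close> is a sum of squares. Measured by a faithful positive functional \<open>g\<close>, the powers of \<open>\<tau>\<close>
  are therefore bounded, so \<open>\<tau>\<close> has no nontrivial Jordan blocks and its eigenvectors span the
  algebra. If \<open>\<tau> v = z v\<close> with \<open>|z| = 1\<close>, then \<open>d = \<tau> (v\<^sup>* v) - v\<^sup>* v \<ge> 0\<close> and the series of
  the \<open>g (\<tau>\<^sup>n d)\<close> has nonnegative terms and bounded partial sums; as \<open>g (\<tau>\<^sup>n d)\<close> satisfies a linear
  recurrence with unimodular roots, \<open>g d = 0\<close> and hence \<open>d = 0\<close>. So the positive sesquilinear
  map \<open>\<tau> (x\<^sup>* y) - \<tau> x\<^sup>* \<tau> y\<close> vanishes on the diagonal at all eigenvectors; by positivity it
  vanishes at all pairs of eigenvectors, hence everywhere.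
\<close>

section \<open>Operators on finite dimensional complex vector spaces\<close>

lemma linear_simps:
  assumes "Vector_Spaces.linear s1 s2 f"
  shows "f (x + y) = f x + f y" "f (s1 c x) = s2 c (f x)" "f (x - y) = f x - f y" "f 0 = 0"
    "f (sum g I) = (\<Sum>i\<in>I. f (g i))"
proof -
  interpret Vector_Spaces.linear s1 s2 f by fact
  show "f (x + y) = f x + f y" "f (s1 c x) = s2 c (f x)" "f (x - y) = f x - f y" "f 0 = 0"
    "f (sum g I) = (\<Sum>i\<in>I. f (g i))"
    by (simp_all add: add scale diff zero sum)
qed

lemma linear_scaleCI:
  fixes f :: "'a::complex_vector \<Rightarrow> 'b::complex_vector"
  assumes "\<And>x y. f (x + y) = f x + f y" "\<And>c x. f (c *\<^sub>C x) = c *\<^sub>C f x"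
  shows "Vector_Spaces.linear scaleC scaleC f"
  by unfold_locales
    (simp_all add: assms scaleC_add_right scaleC_add_left scaleC_scaleC scaleC_one)

lemma linear_scaleC_multI:
  fixes f :: "'a::complex_vector \<Rightarrow> complex"
  assumes "\<And>x y. f (x + y) = f x + f y" "\<And>c x. f (c *\<^sub>C x) = c * f x"
  shows "Vector_Spaces.linear scaleC (*) f"
  by unfold_locales (simp_all add: assms algebra_simps scaleC_add_right scaleC_add_left scaleC_scaleC scaleC_one)

section \<open>Iterates of an operator and products of linear factors that kill a vector\<close>

lemma funpow_linear:
  fixes T :: "'a::complex_vector \<Rightarrow> 'a"
  assumes T: "Vector_Spaces.linear scaleC scaleC T"
  shows "Vector_Spaces.linear scaleC scaleC (T ^^ n)"
proof (induction n)
  case 0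
  show ?case
    by (intro linear_scaleCI) simp_all
next
  case (Suc n)
  show ?case
    by (intro linear_scaleCI) (simp_all add: linear_simps[OF T] linear_simps[OF Suc])
qed

text \<open>The list holds the roots, with multiplicity, of a split polynomial in \<open>T\<close>
  that kills \<open>x\<close>; the recursion lets inductions peel off one factor
  \<open>T - z\<close> at a time.\<close>

primrec annihilates :: "('a::complex_vector \<Rightarrow> 'a) \<Rightarrow> complex list \<Rightarrow> 'a \<Rightarrow> bool" where
  "annihilates T [] x \<longleftrightarrow> x = 0"
| "annihilates T (z # zs) x \<longleftrightarrow> annihilates T zs (T x - z *\<^sub>C x)"

definition poly_op :: "complex poly \<Rightarrow> ('a::complex_vector \<Rightarrow> 'a) \<Rightarrow> 'a \<Rightarrow> 'a" where
  "poly_op p T x = (\<Sum>i\<le>degree p. coeff p i *\<^sub>C (T ^^ i) x)"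

lemma poly_op_atMost:
  assumes "degree p \<le> n"
  shows "poly_op p T x = (\<Sum>i\<le>n. coeff p i *\<^sub>C (T ^^ i) x)"
  unfolding poly_op_def
  by (rule sum.mono_neutral_left) (use assms in \<open>auto simp: coeff_eq_0\<close>)

lemma poly_op_linear_factor:
  assumes T: "Vector_Spaces.linear scaleC scaleC T"
  shows "poly_op ([:-z, 1:] * q) T x = poly_op q T (T x - z *\<^sub>C x)"
proof -
  define n where "n = degree q"
  have pow: "(T ^^ i) (u - c *\<^sub>C v) = (T ^^ i) u - c *\<^sub>C (T ^^ i) v" for i u v c
    by (simp add: linear_simps[OF funpow_linear[OF T]])
  \<comment> \<open>Only an upper bound: for \<open>q = 0\<close> the product has degree 0, not
    \<open>Suc n\<close>.\<close>
  have "degree ([:-z, 1:] * q) \<le> Suc n"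
    using degree_mult_le[of "[:-z, 1:]" q] by (simp add: n_def)
  then have "poly_op ([:-z, 1:] * q) T x
      = (\<Sum>i\<le>Suc n. coeff (pCons 0 q) i *\<^sub>C (T ^^ i) x)
        - (\<Sum>i\<le>Suc n. (z * coeff q i) *\<^sub>C (T ^^ i) x)"
    by (simp only: poly_op_atMost sum_subtractf[symmetric]
        complex_vector.scale_left_diff_distrib[symmetric]) simp
  also have "(\<Sum>i\<le>Suc n. coeff (pCons 0 q) i *\<^sub>C (T ^^ i) x)
      = (\<Sum>i\<le>n. coeff q i *\<^sub>C (T ^^ i) (T x))"
    by (subst sum.atMost_Suc_shift) (simp add: funpow_swap1)
  also have "(\<Sum>i\<le>Suc n. (z * coeff q i) *\<^sub>C (T ^^ i) x)
      = (\<Sum>i\<le>n. coeff q i *\<^sub>C z *\<^sub>C (T ^^ i) x)"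
    by (simp add: n_def coeff_eq_0 scaleC_scaleC mult.commute)
  finally show ?thesis
    by (simp add: poly_op_def n_def pow complex_vector.scale_right_diff_distrib sum_subtractf)
qed

text \<open>The fundamental theorem of algebra provides a root \<open>z\<close> of \<open>p\<close>;
  its factor \<open>T - z\<close> moves onto the vector, leaving a quotient of smaller
  degree.\<close>

lemma annihilates_if_poly_op_eq_0:
  assumes T: "Vector_Spaces.linear scaleC scaleC T" and "p \<noteq> 0" "poly_op p T x = 0"
  shows "\<exists>zs. annihilates T zs x"
  using assms(2,3)
proof (induction "degree p" arbitrary: p x)
  case 0
  then obtain c where "p = [:c:]" "c \<noteq> 0"
    by (metis degree_eq_zeroE pCons_0_0)
  with 0 have "x = 0"
    by (simp add: poly_op_def)
  then have "annihilates T [] x"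
    by simp
  then show ?case ..
next
  case (Suc n)
  have "\<not> constant (poly p)"
    using Suc.hyps(2) by (simp add: constant_degree)
  then obtain z where "poly p z = 0"
    using fundamental_theorem_of_algebra by blast
  then obtain q where q: "p = [:-z, 1:] * q"
    by (auto simp: poly_eq_0_iff_dvd dvd_def)
  with Suc.prems(1) have "q \<noteq> 0" "degree p = Suc (degree q)"
    by (auto simp del: mult_pCons_left simp: degree_mult_eq)
  moreover have "poly_op q T (T x - z *\<^sub>C x) = 0"
    using Suc.prems(2) poly_op_linear_factor[OF T] unfolding q by metis
  ultimately obtain zs where "annihilates T zs (T x - z *\<^sub>C x)"
    using Suc.hyps by (metis Suc_inject)
  then have "annihilates T (z # zs) x"
    by simp
  then show ?case ..
qed

text \<open>More iterates of \<open>x\<close> than the size of a spanning set are linearly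
  dependent, and the coefficients of a relation form a polynomial that kills
  \<open>x\<close>.\<close>

lemma finite_dimensional_annihilates:
  fixes T :: "'a::complex_vector \<Rightarrow> 'a"
  assumes fin: "finite_dimensional TYPE('a)" and T: "Vector_Spaces.linear scaleC scaleC T"
  shows "\<exists>zs. annihilates T zs x"
proof -
  obtain B :: "'a set" where B: "finite B" "complex_vector.span B = UNIV"
    using fin unfolding finite_dimensional_def by blast
  define n where "n = card B"
  let ?v = "\<lambda>i. (T ^^ i) x"
  have "\<exists>p. p \<noteq> 0 \<and> poly_op p T x = 0"
  \<comment> \<open>If two iterates coincide, the set of iterates is too small for the dimension
    count; a difference of two monomials then serves as the polynomial.\<close>
  proof (cases "inj_on ?v {..n}")
    case True
    then have "card (?v ` {..n}) = Suc n"
      by (simp add: card_image)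
    then have "complex_vector.dependent (?v ` {..n})"
      using complex_vector.independent_span_bound[OF B(1), of "?v ` {..n}"] B(2) n_def by force
    then obtain u k where u: "k \<le> n" "u (?v k) \<noteq> 0" "(\<Sum>v\<in>?v ` {..n}. u v *\<^sub>C v) = 0"
      by (subst (asm) complex_vector.dependent_finite) auto
    define p where "p = (\<Sum>i\<le>n. monom (u (?v i)) i)"
    have c: "coeff p i = (if i \<le> n then u (?v i) else 0)" for i
      by (simp add: p_def coeff_sum)
    then have "p \<noteq> 0"
      using u by (metis coeff_0)
    have "degree p \<le> n"
      using c by (intro degree_le) auto
    then have "poly_op p T x = (\<Sum>i\<le>n. u (?v i) *\<^sub>C ?v i)"
      by (simp add: poly_op_atMost c)
    moreover have "(\<Sum>i\<le>n. u (?v i) *\<^sub>C ?v i) = 0"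
      using u(3) unfolding sum.reindex[OF True] by simp
    ultimately have "poly_op p T x = 0"
      by (rule trans)
    with \<open>p \<noteq> 0\<close> show ?thesis
      by (intro exI conjI)
  next
    case False
    then obtain k l where "?v k = ?v l" "k \<noteq> l"
      by (auto simp: inj_on_def)
    then obtain i j where ij: "?v i = ?v j" "i < j"
      by (cases "k < l") (auto dest: sym)
    define p where "p = (monom 1 i - monom 1 j :: complex poly)"
    have c: "coeff p k = (if k = i then 1 else 0) - (if k = j then 1 else 0)" for k
      by (auto simp: p_def)
    have "p \<noteq> 0"
      using c[of i] ij by auto
    have "degree p \<le> j"
      using ij(2) c by (intro degree_le) auto
    then have "poly_op p T x = ?v i - ?v j"
      using ij(2) by (simp add: poly_op_atMost c complex_vector.scale_left_diff_distrib
          sum_subtractf if_distrib[of "\<lambda>c. c *\<^sub>C _"] cong: if_cong)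
    moreover have "?v i - ?v j = 0"
      using ij(1) by simp
    ultimately have "poly_op p T x = 0"
      by (rule trans)
    with \<open>p \<noteq> 0\<close> show ?thesis
      by (intro exI conjI)
  qed
  then show ?thesis
    using annihilates_if_poly_op_eq_0[OF T] by blast
qed

section \<open>Eigenvectors and semisimplicity\<close>

lemma eigenvalue_in_op_spectrum:
  assumes T: "Vector_Spaces.linear scaleC scaleC T" and "T v = z *\<^sub>C v" "v \<noteq> 0"
  shows "z \<in> op_spectrum T"
proof -
  have "\<not> inj (\<lambda>x. T x - z *\<^sub>C x)"
    using assms(2,3) linear_simps(4)[OF T] injD[of "\<lambda>x. T x - z *\<^sub>C x" v 0] by auto
  then show ?thesis
    by (auto simp: op_spectrum_def bij_def)
qed

text \<open>For linear \<open>T\<close>: no Jordan chain of length two, so all Jordan blocks are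
  trivial.\<close>

definition semisimple_op :: "('a::complex_vector \<Rightarrow> 'a) \<Rightarrow> bool" where
  "semisimple_op T \<longleftrightarrow>
    (\<forall>z u v. T u - z *\<^sub>C u = v \<longrightarrow> T v = z *\<^sub>C v \<longrightarrow> v = 0)"

definition eigenvecs :: "('a::complex_vector \<Rightarrow> 'a) \<Rightarrow> 'a set" where
  "eigenvecs T = {v. \<exists>z. T v = z *\<^sub>C v}"

text \<open>A vector of the span splits off its component for the eigenvalue \<open>z\<close>; on the
  remaining components \<open>T - z\<close> can be inverted.\<close>

lemma span_eigenvecs_decomp:
  assumes T: "Vector_Spaces.linear scaleC scaleC T"
    and "y \<in> complex_vector.span (eigenvecs T)"
  shows "\<exists>w \<in> complex_vector.span (eigenvecs T). \<exists>v. T v = z *\<^sub>C v \<and> y = (T w - z *\<^sub>C w) + v"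
  using assms(2)
proof (induction rule: complex_vector.span_induct_alt)
  case base
  show ?case
    by (rule bexI[of _ 0], rule exI[of _ 0])
       (auto simp: linear_simps[OF T] complex_vector.span_zero)
next
  case (step c x y)
  then obtain w v where wv: "w \<in> complex_vector.span (eigenvecs T)" "T v = z *\<^sub>C v"
    "y = (T w - z *\<^sub>C w) + v" by blast
  obtain m where m: "T x = m *\<^sub>C x"
    using step by (auto simp: eigenvecs_def)
  show ?case
  proof (cases "m = z")
    case True
    then have "T (v + c *\<^sub>C x) = z *\<^sub>C (v + c *\<^sub>C x)"
      by (simp add: linear_simps[OF T] wv m scaleC_add_right scaleC_scaleC mult.commute)
    moreover have "c *\<^sub>C x + y = (T w - z *\<^sub>C w) + (v + c *\<^sub>C x)"
      by (simp add: wv(3))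
    ultimately show ?thesis
      using wv(1) by blast
  next
    case False
    \<comment> \<open>On \<open>x\<close> the operator \<open>T - z\<close> acts as the scalar
      \<open>m - z\<close>, so dividing by it gives a preimage of
      \<open>c *\<^sub>C x\<close>.\<close>
    define w' where "w' = w + (c / (m - z)) *\<^sub>C x"
    have "w' \<in> complex_vector.span (eigenvecs T)"
      unfolding w'_def using wv(1) step
      by (blast intro: complex_vector.span_add complex_vector.span_scale complex_vector.span_base)
    moreover have "T w' - z *\<^sub>C w' = (T w - z *\<^sub>C w) + ((c / (m - z)) * (m - z)) *\<^sub>C x"
      by (simp add: w'_def linear_simps[OF T] m scaleC_add_right scaleC_scaleC
          complex_vector.scale_left_diff_distrib right_diff_distrib diff_divide_distrib mult.commute)
    then have "c *\<^sub>C x + y = (T w' - z *\<^sub>C w') + v"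
      using False wv(3) by simp
    ultimately show ?thesis
      using wv(2) by blast
  qed
qed

text \<open>If \<open>(T - z) x = (T - z) w + v\<close> with \<open>v\<close> in the kernel of
  \<open>T - z\<close>, then \<open>x - w\<close> starts a Jordan chain ending in \<open>v\<close>;
  semisimplicity forces \<open>v = 0\<close>, and \<open>x - w\<close> is itself an
  eigenvector.\<close>

lemma annihilates_imp_span_eigenvecs:
  assumes T: "Vector_Spaces.linear scaleC scaleC T" and s: "semisimple_op T"
    and "annihilates T zs x"
  shows "x \<in> complex_vector.span (eigenvecs T)"
  using assms(3)
proof (induction zs arbitrary: x)
  case Nil
  then show ?case
    by (simp add: complex_vector.span_zero)
next
  case (Cons z zs)
  then have "T x - z *\<^sub>C x \<in> complex_vector.span (eigenvecs T)"
    by simp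
  then obtain w v where wv: "w \<in> complex_vector.span (eigenvecs T)" "T v = z *\<^sub>C v"
    "T x - z *\<^sub>C x = (T w - z *\<^sub>C w) + v"
    using span_eigenvecs_decomp[OF T] by blast
  have v: "T (x - w) - z *\<^sub>C (x - w) = v"
    using wv(3) by (simp add: linear_simps[OF T] complex_vector.scale_right_diff_distrib algebra_simps)
  then have "v = 0"
    using s wv(2) unfolding semisimple_op_def by blast
  with v have "x - w \<in> complex_vector.span (eigenvecs T)"
    by (intro complex_vector.span_base) (auto simp: eigenvecs_def)
  then have "(x - w) + w \<in> complex_vector.span (eigenvecs T)"
    using wv(1) complex_vector.span_add by blast
  then show ?case
    by simp
qed

lemma semisimple_span_eigenvecs:
  fixes T :: "'a::complex_vector \<Rightarrow> 'a"
  assumes "finite_dimensional TYPE('a)" "Vector_Spaces.linear scaleC scaleC T" "semisimple_op T"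
  shows "complex_vector.span (eigenvecs T) = UNIV"
proof -
  have "x \<in> complex_vector.span (eigenvecs T)" for x
    using finite_dimensional_annihilates[OF assms(1,2), of x]
      annihilates_imp_span_eigenvecs[OF assms(2,3)] by (elim exE)
  then show ?thesis
    by auto
qed

section \<open>Restriction to eigenvalues, and recurrences with unimodular roots\<close>

lemma annihilates_cancel_factor:
  assumes T: "Vector_Spaces.linear scaleC scaleC T"
    and inj: "\<And>x. T x = z *\<^sub>C x \<Longrightarrow> x = 0"
    and "annihilates T zs (T x - z *\<^sub>C x)"
  shows "annihilates T zs x"
  using assms(3)
proof (induction zs arbitrary: x)
  case Nil
  then have "x = 0"
    by (intro inj) simp
  then show ?case
    by simp
next
  case (Cons y zs)
  have "T (T x - z *\<^sub>C x) - y *\<^sub>C (T x - z *\<^sub>C x) = T (T x - y *\<^sub>C x) - z *\<^sub>C (T x - y *\<^sub>C x)"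
    by (simp add: linear_simps[OF T] complex_vector.scale_right_diff_distrib scaleC_scaleC mult.commute)
  with Cons.prems have "annihilates T zs (T (T x - y *\<^sub>C x) - z *\<^sub>C (T x - y *\<^sub>C x))"
    by simp
  then show ?case
    unfolding annihilates.simps by (rule Cons.IH)
qed

lemma annihilates_eigenvalues:
  assumes T: "Vector_Spaces.linear scaleC scaleC T" and "annihilates T zs x"
  shows "\<exists>ys. annihilates T ys x \<and> (\<forall>z\<in>set ys. \<exists>v. v \<noteq> 0 \<and> T v = z *\<^sub>C v)"
  using assms(2)
proof (induction zs arbitrary: x)
  case Nil
  then have "annihilates T [] x \<and> (\<forall>z\<in>set []. \<exists>v. v \<noteq> 0 \<and> T v = z *\<^sub>C v)"
    by simp
  then show ?case ..
next
  case (Cons z zs)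
  then obtain ys where ys: "annihilates T ys (T x - z *\<^sub>C x)"
    "\<forall>z\<in>set ys. \<exists>v. v \<noteq> 0 \<and> T v = z *\<^sub>C v" by force
  show ?case
  proof (cases "\<exists>v. v \<noteq> 0 \<and> T v = z *\<^sub>C v")
    case True
    with ys have "annihilates T (z # ys) x \<and> (\<forall>z\<in>set (z # ys). \<exists>v. v \<noteq> 0 \<and> T v = z *\<^sub>C v)"
      by simp
    then show ?thesis ..
  next
    case False
    then show ?thesis
      using annihilates_cancel_factor[OF T _ ys(1)] ys(2) by blast
  qed
qed

text \<open>The sequence of \<open>T x - z *\<^sub>C x\<close> also tends to 0, so by induction it
  vanishes. The sequence of \<open>x\<close> is then geometric with ratio \<open>z\<close>, hence of
  constant modulus, and its limit 0 makes it zero.\<close>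

lemma annihilates_unimodular_tendsto_0:
  fixes g :: "'a::complex_vector \<Rightarrow> complex"
  assumes T: "Vector_Spaces.linear scaleC scaleC T" and g: "Vector_Spaces.linear scaleC (*) g"
    and "annihilates T zs x" "\<forall>z\<in>set zs. cmod z = 1" "(\<lambda>n. g ((T ^^ n) x)) \<longlonglongrightarrow> 0"
  shows "g ((T ^^ n) x) = 0"
  using assms(3-)
proof (induction zs arbitrary: x n)
  case Nil
  then show ?case
    by (simp add: linear_simps[OF g] linear_simps[OF funpow_linear[OF T]])
next
  case (Cons z zs)
  have pow: "(T ^^ i) (u - c *\<^sub>C v) = (T ^^ i) u - c *\<^sub>C (T ^^ i) v" for i u v c
    by (simp add: linear_simps[OF funpow_linear[OF T]])
  have eq: "g ((T ^^ n) (T x - z *\<^sub>C x)) = g ((T ^^ Suc n) x) - z * g ((T ^^ n) x)" for n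
    by (simp add: pow linear_simps[OF g] funpow_swap1)
  have "(\<lambda>n. g ((T ^^ n) (T x - z *\<^sub>C x))) \<longlonglongrightarrow> 0 - z * 0"
    unfolding eq by (intro tendsto_diff tendsto_mult tendsto_const LIMSEQ_Suc) (use Cons in auto)
  then have "g ((T ^^ n) (T x - z *\<^sub>C x)) = 0" for n
    using Cons by simp
  then have rec: "g ((T ^^ Suc n) x) = z * g ((T ^^ n) x)" for n
    using eq by (metis eq_iff_diff_eq_0)
  have z: "cmod z = 1"
    using Cons.prems by simp
  have "cmod (g ((T ^^ m) x)) = cmod (g x)" for m
    by (induction m) (use rec z in \<open>simp_all add: norm_mult\<close>)
  moreover have "(\<lambda>n. cmod (g ((T ^^ n) x))) \<longlonglongrightarrow> 0"
    using Cons.prems by (intro tendsto_norm_zero) auto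
  ultimately show ?case
    by (simp add: LIMSEQ_const_iff)
qed

subsection \<open>The trace\<close>

definition op_trace :: "'a::complex_vector set \<Rightarrow> ('a \<Rightarrow> 'a) \<Rightarrow> complex" where
  "op_trace B F = (\<Sum>b\<in>B. complex_vector.representation B (F b) b)"

definition is_basis :: "'a::complex_vector set \<Rightarrow> bool" where
  "is_basis B \<longleftrightarrow> finite B \<and> complex_vector.independent B \<and> complex_vector.span B = UNIV"

lemma is_basis_subset:
  fixes S :: "'a::complex_vector set"
  assumes "finite_dimensional TYPE('a)" "complex_vector.span S = UNIV"
  obtains B where "B \<subseteq> S" "is_basis B"
proof -
  obtain B where B: "B \<subseteq> S" "complex_vector.independent B" "S \<subseteq> complex_vector.span B"
    using complex_vector.maximal_independent_subset by blast
  then have "complex_vector.span B = UNIV"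
    by (metis assms(2) complex_vector.span_minimal complex_vector.subspace_span top.extremum_uniqueI)
  moreover have "finite B"
    using assms(1) B(2) complex_vector.independent_span_bound
    unfolding finite_dimensional_def by (metis top_greatest)
  ultimately show ?thesis
    using B that by (simp add: is_basis_def)
qed

text \<open>Two different bases are allowed so that taking \<open>G\<close> to be the identity gives
  independence of the basis.\<close>

lemma op_trace_comp_commute:
  fixes F G :: "'a::complex_vector \<Rightarrow> 'a"
  assumes B: "is_basis B" and B': "is_basis B'"
    and F: "Vector_Spaces.linear scaleC scaleC F" and G: "Vector_Spaces.linear scaleC scaleC G"
  shows "op_trace B (\<lambda>x. F (G x)) = op_trace B' (\<lambda>x. G (F x))"
proof -
  have expand: "op_trace B (\<lambda>x. F (G x)) = (\<Sum>b\<in>B. \<Sum>b'\<in>B'.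
      complex_vector.representation B' (G b) b' * complex_vector.representation B (F b') b)"
    if B: "is_basis B" and B': "is_basis B'" and F: "Vector_Spaces.linear scaleC scaleC F"
    for B B' and F G :: "'a \<Rightarrow> 'a"
    unfolding op_trace_def
  proof (rule sum.cong)
    fix b
    have "G b = (\<Sum>b'\<in>B'. complex_vector.representation B' (G b) b' *\<^sub>C b')"
      using B' by (simp add: complex_vector.sum_representation_eq is_basis_def)
    then have "F (G b) = (\<Sum>b'\<in>B'. complex_vector.representation B' (G b) b' *\<^sub>C F b')"
      by (metis (no_types, lifting) linear_simps(2,5)[OF F] sum.cong)
    then show "complex_vector.representation B (F (G b)) b = (\<Sum>b'\<in>B'.
        complex_vector.representation B' (G b) b' * complex_vector.representation B (F b') b)"
      using B by (simp add: complex_vector.representation_sum complex_vector.representation_scale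
          is_basis_def)
  qed simp
  show ?thesis
    unfolding expand[OF B B' F] expand[OF B' B G]
    by (subst sum.swap) (simp add: mult.commute)
qed

lemma op_trace_basis_independent:
  assumes "is_basis B" "is_basis B'" "Vector_Spaces.linear scaleC scaleC F"
  shows "op_trace B F = op_trace B' F"
  using op_trace_comp_commute[OF assms linear_scaleCI[of "\<lambda>x. x"]] by simp

lemma op_trace_diagonal:
  assumes B: "is_basis B" and F: "\<And>b. b \<in> B \<Longrightarrow> F b = f b *\<^sub>C b"
  shows "op_trace B F = (\<Sum>b\<in>B. f b)"
  unfolding op_trace_def
  using B by (intro sum.cong) (auto simp: F complex_vector.representation_scale
      complex_vector.representation_basis is_basis_def)

section \<open>A faithful positive trace\<close>

lemma star_zero: "star (0::'a::cstar_algebra) = 0"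
  using star_add[of 0 "0::'a"] by simp

lemma star_uminus: "star (- x) = - star (x::'a::cstar_algebra)"
  using star_add[of x "- x"] minus_unique[of "star x" "star (- x)"] by (simp add: star_zero)

lemma star_diff: "star (x - y) = star x - star (y::'a::cstar_algebra)"
  using star_add[of x "- y"] star_uminus[of y] by simp

lemma star_scaleR: "star (r *\<^sub>R x) = r *\<^sub>R star (x::'a::cstar_algebra)"
  by (simp add: scaleR_scaleC star_scaleC)

lemma star_mult_self_eq_0: "star x * x = 0 \<Longrightarrow> x = (0::'a::cstar_algebra)"
  using cstar_identity[of x] by simp

lemma norm_star: "norm (star x) = norm (x::'a::cstar_algebra)"
proof -
  have le: "norm x \<le> norm (star x)" for x :: 'a
  proof (cases "x = 0")
    case False
    have "norm x * norm x \<le> norm (star x) * norm x"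
      using cstar_identity[of x] norm_mult_ineq[of "star x" x] by (simp add: power2_eq_square)
    with False show ?thesis
      by simp
  qed simp
  show ?thesis
    using le[of x] le[of "star x"] by (simp add: star_star)
qed

lemma is_identityD:
  assumes "is_identity e"
  shows "e * x = x" "x * e = x"
  using assms by (simp_all add: is_identity_def)

lemma is_identity_unique: "is_identity e \<Longrightarrow> is_identity e' \<Longrightarrow> e = e'"
  by (metis is_identityD)

lemma star_identity:
  assumes e: "is_identity e"
  shows "star e = e"
proof -
  have "star e = star e * e"
    using is_identityD[OF e] by simp
  also have "\<dots> = star (star e * e)"
    by (simp add: star_mult star_star)
  also have "\<dots> = e"
    using is_identityD[OF e] by (simp add: star_star)
  finally show ?thesis .
qed

lemma linear_mult_left: "Vector_Spaces.linear scaleC scaleC (\<lambda>y. x * (y::'a::cstar_algebra))"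
  by (intro linear_scaleCI) (simp_all add: distrib_left mult_scaleC_right)

text \<open>The element \<open>star v * v\<close>, nonzero by the C*-identity, replaces the inner
  product: \<open>star v * h * v\<close> is evaluated from both sides.\<close>

lemma selfadjoint_eigenvalue_real:
  fixes h v :: "'a::cstar_algebra"
  assumes "star h = h" "h * v = z *\<^sub>C v" "v \<noteq> 0"
  shows "cnj z = z"
proof -
  have "z *\<^sub>C (star v * v) = star v * (h * v)"
    by (simp add: assms(2) mult_scaleC_right)
  also have "\<dots> = star (h * v) * v"
    by (simp add: star_mult assms(1) mult.assoc)
  also have "\<dots> = cnj z *\<^sub>C (star v * v)"
    by (simp add: assms(2) star_scaleC mult_scaleC_left)
  finally show ?thesis
    using star_mult_self_eq_0 assms(3) by auto
qed

text \<open>With \<open>z\<close> real, \<open>v\<close> lies in both the range and the kernel of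
  the self-adjoint \<open>h - z\<close>, so \<open>star v * v = 0\<close>.\<close>

lemma semisimple_selfadjoint:
  fixes h :: "'a::cstar_algebra"
  assumes h: "star h = h"
  shows "semisimple_op (\<lambda>y. h * y)"
  unfolding semisimple_op_def
proof (intro allI impI)
  fix z u v
  assume u: "h * u - z *\<^sub>C u = v" and v: "h * v = z *\<^sub>C v"
  show "v = 0"
  proof (rule ccontr)
    assume "v \<noteq> 0"
    then have z: "cnj z = z"
      using selfadjoint_eigenvalue_real h v by blast
    have "star v = star u * h - z *\<^sub>C star u"
      using z by (simp add: u[symmetric] star_diff star_mult star_scaleC h)
    then have "star v * v = star u * (h * v) - z *\<^sub>C (star u * v)"
      by (simp add: left_diff_distrib mult_scaleC_left mult.assoc)
    also have "\<dots> = 0"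
      by (simp add: v mult_scaleC_right)
    finally show False
      using \<open>v \<noteq> 0\<close> star_mult_self_eq_0 by blast
  qed
qed

text \<open>In a basis of eigenvectors of left multiplication by \<open>h\<close>, the trace is the
  sum of the squares of real eigenvalues.\<close>

lemma op_trace_selfadjoint_square:
  fixes h :: "'a::cstar_algebra"
  assumes fin: "finite_dimensional TYPE('a)" and B: "is_basis B" and h: "star h = h"
  shows "\<exists>r\<ge>0. op_trace B (\<lambda>y. h * h * y) = complex_of_real r \<and> (r = 0 \<longrightarrow> (\<forall>y. h * y = 0))"
proof -
  obtain B' where B': "B' \<subseteq> eigenvecs (\<lambda>y. h * y)" "is_basis B'"
    using is_basis_subset[OF fin semisimple_span_eigenvecs[OF fin linear_mult_left
          semisimple_selfadjoint[OF h]]] by blast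
  have "\<forall>b\<in>B'. \<exists>z. h * b = z *\<^sub>C b"
    using B'(1) by (auto simp: eigenvecs_def)
  then obtain f where f: "\<And>b. b \<in> B' \<Longrightarrow> h * b = f b *\<^sub>C b"
    by metis
  have real: "f b = complex_of_real (Re (f b))" if "b \<in> B'" for b
  proof -
    have "b \<noteq> 0"
      using B'(2) that complex_vector.dependent_zero by (auto simp: is_basis_def)
    then have "cnj (f b) = f b"
      using selfadjoint_eigenvalue_real h f that by blast
    then show ?thesis
      by (simp add: complex_eq_iff)
  qed
  define r where "r = (\<Sum>b\<in>B'. (Re (f b))\<^sup>2)"
  have "op_trace B (\<lambda>y. h * h * y) = op_trace B' (\<lambda>y. h * h * y)"
    by (intro op_trace_basis_independent B B' linear_mult_left)
  also have "\<dots> = (\<Sum>b\<in>B'. (f b)\<^sup>2)"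
    by (intro op_trace_diagonal B')
       (simp add: f mult.assoc mult_scaleC_right scaleC_scaleC power2_eq_square)
  also have "\<dots> = (\<Sum>b\<in>B'. complex_of_real ((Re (f b))\<^sup>2))"
    by (intro sum.cong refl) (metis real of_real_power)
  also have "\<dots> = complex_of_real r"
    by (simp add: r_def)
  finally have tr: "op_trace B (\<lambda>y. h * h * y) = complex_of_real r" .
  have "h * y = 0" if "r = 0" for y
  proof -
    have "\<forall>b\<in>B'. Re (f b) = 0"
      using that B'(2) by (auto simp: r_def sum_nonneg_eq_0_iff is_basis_def)
    then have f0: "h * b = 0" if "b \<in> B'" for b
      using that f real by (metis complex_vector.scale_zero_left of_real_0)
    have "y \<in> complex_vector.span B'"
      using B'(2) by (simp add: is_basis_def)
    then show ?thesis
      by (induction rule: complex_vector.span_induct_alt)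
         (simp_all add: distrib_left mult_scaleC_right f0)
  qed
  moreover have "r \<ge> 0"
    by (simp add: r_def sum_nonneg)
  ultimately show ?thesis
    using tr by blast
qed

definition faithful_positive :: "('a::cstar_algebra \<Rightarrow> complex) \<Rightarrow> bool" where
  "faithful_positive g \<longleftrightarrow> Vector_Spaces.linear scaleC (*) g \<and>
    (\<forall>x. Im (g (star x * x)) = 0 \<and> Re (g (star x * x)) \<ge> 0 \<and> (g (star x * x) = 0 \<longrightarrow> x = 0))"

text \<open>The trace of the left regular representation works: modulo commutators \<open>4 x\<^sup>* x\<close> is a
  sum of two squares of self-adjoint elements, whose left multiplications are diagonalizable
  with real eigenvalues.\<close>

lemma exists_faithful_positive:
  fixes e :: "'a::cstar_algebra"
  assumes fin: "finite_dimensional TYPE('a)" and e: "is_identity e"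
  shows "\<exists>g :: 'a \<Rightarrow> complex. faithful_positive g"
proof -
  obtain B :: "'a set" where B: "is_basis B"
    using is_basis_subset[OF fin complex_vector.span_UNIV] by blast
  define g where "g x = op_trace B (\<lambda>y. x * y)" for x :: 'a
  have g: "Vector_Spaces.linear scaleC (*) g"
    using B unfolding g_def op_trace_def is_basis_def
    by (intro linear_scaleC_multI)
       (simp_all add: distrib_right mult_scaleC_left complex_vector.representation_add
          complex_vector.representation_scale sum.distrib sum_distrib_left)
  have comm: "g (x * y) = g (y * x)" for x y
    using op_trace_comp_commute[OF B B linear_mult_left linear_mult_left, of x y]
    by (simp add: g_def mult.assoc)
  have "Im (g (star x * x)) = 0 \<and> Re (g (star x * x)) \<ge> 0 \<and> (g (star x * x) = 0 \<longrightarrow> x = 0)" for x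
  proof -
    \<comment> \<open>Up to sign, twice the real and twice the imaginary part of
      \<open>x\<close>.\<close>
    define h k where "h = x + star x" and "k = \<i> *\<^sub>C (x - star x)"
    have h: "star h = h"
      by (simp add: h_def star_add star_star add.commute)
    have k: "star k = k"
      by (simp add: k_def star_diff star_star star_scaleC complex_vector.scale_right_diff_distrib)
    obtain r where r: "r \<ge> 0" "g (h * h) = complex_of_real r" "r = 0 \<Longrightarrow> h * e = 0"
      using op_trace_selfadjoint_square[OF fin B h] by (auto simp: g_def)
    obtain s where s: "s \<ge> 0" "g (k * k) = complex_of_real s" "s = 0 \<Longrightarrow> k * e = 0"
      using op_trace_selfadjoint_square[OF fin B k] by (auto simp: g_def)
    \<comment> \<open>In \<open>h * h + k * k\<close> the terms \<open>x * x\<close> and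
      \<open>star x * star x\<close> cancel; the trace property merges the mixed terms into
      \<open>4 * g (star x * x)\<close>.\<close>
    have "h * h = x * x + star x * star x + (x * star x + star x * x)"
      by (simp add: h_def algebra_simps)
    moreover have "k * k = (-1) *\<^sub>C (x * x + star x * star x - (x * star x + star x * x))"
      unfolding k_def mult_scaleC_left mult_scaleC_right scaleC_scaleC
      by (simp add: algebra_simps)
    ultimately have "g (h * h) + g (k * k) = 4 * g (star x * x)"
      by (simp add: linear_simps[OF g] comm[of x "star x"])
    then have sum: "complex_of_real (r + s) = 4 * g (star x * x)"
      using r s by simp
    have "x = 0" if "g (star x * x) = 0"
    proof -
      have "r + s = 0"
        using sum that by (metis mult_zero_right of_real_eq_0_iff)
      then have "h = 0" "k = 0"
        using r s is_identityD[OF e] by (auto simp: add_nonneg_eq_0_iff)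
      then have "x + star x = 0" "x - star x = 0"
        by (auto simp: h_def k_def)
      then have "2 *\<^sub>R x = 0"
        by (simp add: scaleR_2)
      then show ?thesis
        by simp
    qed
    moreover have "4 * Im (g (star x * x)) = 0" "4 * Re (g (star x * x)) = r + s"
      using arg_cong[OF sum, of Im] arg_cong[OF sum, of Re] by simp_all
    ultimately show ?thesis
      using r(1) s(1) by auto
  qed
  with g show ?thesis
    unfolding faithful_positive_def by blast
qed

section \<open>Sums of squares\<close>

text \<open>The cone that serves as the positive elements and defines the order.\<close>

inductive_set sums_of_squares :: "'a::cstar_algebra set" where
  zero: "0 \<in> sums_of_squares"
| step: "x \<in> sums_of_squares \<Longrightarrow> x + star y * y \<in> sums_of_squares"

lemma sums_of_squares_square: "star y * y \<in> sums_of_squares"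
  using sums_of_squares.step[OF sums_of_squares.zero] by simp

lemma sums_of_squares_add:
  assumes "y \<in> sums_of_squares" "x \<in> sums_of_squares"
  shows "x + y \<in> sums_of_squares"
  using assms
  by induction (auto simp: add.assoc[symmetric] intro: sums_of_squares.step)

lemma faithful_positive_sums_of_squares:
  assumes g: "faithful_positive g" and "x \<in> sums_of_squares"
  shows "Im (g x) = 0 \<and> Re (g x) \<ge> 0 \<and> (g x = 0 \<longrightarrow> x = 0)"
proof -
  have lin: "Vector_Spaces.linear scaleC (*) g"
    and sq: "\<And>x. Im (g (star x * x)) = 0" "\<And>x. Re (g (star x * x)) \<ge> 0"
      "\<And>x. g (star x * x) = 0 \<Longrightarrow> x = 0"
    using g by (auto simp: faithful_positive_def)
  show ?thesis
    using assms(2)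
  proof induction
    case zero
    show ?case
      by (simp add: linear_simps[OF lin])
  next
    case (step x y)
    have eq: "g (x + star y * y) = g x + g (star y * y)"
      by (simp add: linear_simps[OF lin])
    have "x + star y * y = 0" if "g (x + star y * y) = 0"
    proof -
      have "Re (g x) + Re (g (star y * y)) = 0"
        using that eq by (metis plus_complex.simps(1) zero_complex.simps(1))
      then have "g x = 0" "g (star y * y) = 0"
        using step.IH sq(1,2)[of y] by (auto simp: complex_eq_iff)
      then have "x = 0" "y = 0"
        using step.IH sq(3) by blast+
      then show ?thesis
        by simp
    qed
    then show ?case
      using eq step.IH sq(1,2)[of y] by auto
  qed
qed

text \<open>Both \<open>g x\<close> and \<open>- g x\<close> are nonnegative, so
  \<open>g x = 0\<close> and faithfulness applies.\<close>

lemma sums_of_squares_antisym: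
  fixes g :: "'a::cstar_algebra \<Rightarrow> complex" and x :: 'a
  assumes g: "faithful_positive g" and "x \<in> sums_of_squares" "- x \<in> sums_of_squares"
  shows "x = 0"
proof -
  have "Vector_Spaces.linear scaleC (*) g"
    using g by (simp add: faithful_positive_def)
  then have "g (- x) = - g x"
    using linear_simps(3,4)[of scaleC "(*)" g] by (metis diff_0)
  then have "Re (g x) = 0" "Im (g x) = 0"
    using faithful_positive_sums_of_squares[OF g assms(2)]
      faithful_positive_sums_of_squares[OF g assms(3)] by auto
  then show ?thesis
    using faithful_positive_sums_of_squares[OF g assms(2)] by (simp add: complex_eq_iff)
qed

text \<open>The Banach fixed point \<open>u\<close> of \<open>u \<mapsto> (h + u\<^sup>2)/2\<close> makes \<open>1 - u\<close> a square root of
  \<open>1 - h\<close>.\<close>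

lemma sqrt_one_minus:
  fixes h e :: "'a::cstar_algebra"
  assumes e: "is_identity e" and h: "star h = h" "norm h \<le> 1/2"
  shows "\<exists>s. star s = s \<and> s * s = e - h"
proof -
  define F where "F u = (1/2) *\<^sub>R (h + u * u)" for u
  have unique: "\<exists>!u. u \<in> cball 0 (1/2) \<and> F u = u"
  \<comment> \<open>On the ball of radius 1/2 one has \<open>norm (u * u) \<le> 1/4\<close>, which
    keeps the ball invariant, and the Lipschitz constant \<open>(norm u + norm v) / 2\<close> is at
    most 1/2.\<close>
  proof (rule Banach_fix[of _ "1/2"])
    show "F ` cball 0 (1/2) \<subseteq> cball 0 (1/2)"
    proof (clarsimp simp: F_def)
      fix u :: 'a
      assume "norm u * 2 \<le> 1"
      then have "norm (u * u) \<le> 1/2 * (1/2)"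
        by (intro order_trans[OF norm_mult_ineq] mult_mono) auto
      then show "norm (h + u * u) \<le> 1"
        using h(2) norm_triangle_ineq[of h "u * u"] by simp
    qed
    fix u v :: 'a
    assume uv: "u \<in> cball 0 (1/2)" "v \<in> cball 0 (1/2)"
    \<comment> \<open>This factorization holds without commutativity.\<close>
    have "u * u - v * v = u * (u - v) + (u - v) * v"
      by (simp add: algebra_simps)
    then have "norm (u * u - v * v) \<le> norm u * norm (u - v) + norm (u - v) * norm v"
      using norm_triangle_ineq[of "u * (u - v)" "(u - v) * v"] norm_mult_ineq[of u "u - v"]
        norm_mult_ineq[of "u - v" v] by simp
    also have "\<dots> \<le> 1/2 * norm (u - v) + norm (u - v) * (1/2)"
      using uv by (intro add_mono mult_right_mono mult_left_mono) auto
    finally have "norm (u * u - v * v) \<le> norm (u - v)"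
      by simp
    moreover have "F u - F v = (1/2) *\<^sub>R (u * u - v * v)"
      by (simp add: F_def algebra_simps)
    ultimately show "dist (F u) (F v) \<le> 1/2 * dist u v"
      by (simp add: dist_norm)
  qed (auto simp: complete_eq_closed)
  then obtain u where u: "u \<in> cball 0 (1/2)" "F u = u"
    by blast
  \<comment> \<open>As \<open>star\<close> is isometric, \<open>star u\<close> is a fixed point in
    the same ball, so uniqueness makes \<open>u\<close> self-adjoint.\<close>
  have "F (star u) = star (F u)"
    by (simp add: F_def star_scaleR star_add star_mult h(1))
  then have "star u = u"
    using unique u by (metis dist_0_norm mem_cball norm_star)
  moreover have "h + u * u = 2 *\<^sub>R u"
    using u(2) by (metis F_def scaleR_half_double scaleR_2 scaleR_right_distrib)
  then have "(e - u) * (e - u) = e - h"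
    using is_identityD[OF e] by (simp add: algebra_simps scaleR_2)
  ultimately show ?thesis
    by (intro exI[of _ "e - u"]) (simp add: star_diff star_identity[OF e])
qed

text \<open>After scaling \<open>h\<close> to norm at most 1/2, \<open>e - h / R\<close> is the
  square of a self-adjoint element.\<close>

lemma sums_of_squares_order_unit:
  fixes h e :: "'a::cstar_algebra"
  assumes e: "is_identity e" and h: "star h = h"
  shows "\<exists>R\<ge>0. R *\<^sub>R e - h \<in> sums_of_squares"
proof -
  \<comment> \<open>The summand 1 keeps \<open>R\<close> positive when \<open>h = 0\<close>.\<close>
  define R where "R = 2 * norm h + 1"
  have R: "R > 0"
    by (simp add: R_def add_nonneg_pos)
  have "norm ((1/R) *\<^sub>R h) \<le> 1/2"
    using R by (simp add: R_def field_simps)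
  then obtain s where s: "star s = s" "s * s = e - (1/R) *\<^sub>R h"
    using sqrt_one_minus[OF e, of "(1/R) *\<^sub>R h"] h by (auto simp: star_scaleR)
  have "star (sqrt R *\<^sub>R s) * (sqrt R *\<^sub>R s) = R *\<^sub>R (s * s)"
    using R s(1) by (simp add: star_scaleR)
  also have "\<dots> = R *\<^sub>R e - h"
    using R by (simp add: s(2) scaleR_right_diff_distrib)
  finally show ?thesis
    using sums_of_squares_square R by (metis less_imp_le)
qed

section \<open>Completely positive maps\<close>

lemma star_mat_mult_index:
  assumes Y: "Y \<in> carrier_mat 2 2" and ij: "i < 2" "j < 2"
  shows "(star_mat Y * Y) $$ (i, j)
    = star (Y $$ (0, i)) * Y $$ (0, j) + star (Y $$ (1, i)) * Y $$ (1, j)"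
  using assms by (simp add: star_mat_def scalar_prod_def numeral_2_eq_2)

text \<open>The image of the positive matrix with rows \<open>(1, x)\<close> and \<open>(x\<^sup>*, x\<^sup>* x)\<close> is \<open>Z\<^sup>* Z\<close>
  with columns \<open>V\<close>, \<open>W\<close> of \<open>Z\<close> such that \<open>V\<^sup>* V = 1\<close>; the defect in the Schwarz inequality is the
  square of \<open>W - V V\<^sup>* W\<close>.\<close>

lemma completely_positive_schwarz:
  fixes \<tau> :: "'a::cstar_algebra \<Rightarrow> 'b::cstar_algebra"
  assumes \<tau>: "completely_positive \<tau>" and e: "is_identity e" "is_identity (\<tau> e)"
  shows "\<tau> (star x) = star (\<tau> x)"
    and "\<tau> (star x * x) - star (\<tau> x) * \<tau> x \<in> sums_of_squares"
proof -
  \<comment> \<open>With first row \<open>(e, x)\<close> and second row zero,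
    \<open>star_mat Y * Y\<close> is the matrix described above.\<close>
  define Y where "Y = mat 2 2 (\<lambda>(i, j). if i = 0 then if j = 0 then e else x else 0)"
  have Y: "Y \<in> carrier_mat 2 2"
    by (simp add: Y_def)
  have dim: "dim_row (star_mat Y * Y) = 2" "dim_col (star_mat Y * Y) = 2"
    using Y by (auto simp: star_mat_def)
  have "positive_mat 2 (star_mat Y * Y)"
    using Y unfolding positive_mat_def by blast
  then have "positive_mat 2 (map_mat \<tau> (star_mat Y * Y))"
    using \<tau> by (simp add: completely_positive_def)
  then obtain Z where Z: "Z \<in> carrier_mat 2 2" "map_mat \<tau> (star_mat Y * Y) = star_mat Z * Z"
    unfolding positive_mat_def by blast
  have entry: "\<tau> (star (Y $$ (0, i)) * Y $$ (0, j) + star (Y $$ (1, i)) * Y $$ (1, j))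
      = star (Z $$ (0, i)) * Z $$ (0, j) + star (Z $$ (1, i)) * Z $$ (1, j)"
    if "i < 2" "j < 2" for i j
    using arg_cong[OF Z(2), of "\<lambda>M. M $$ (i, j)"] star_mat_mult_index[OF Y that]
      star_mat_mult_index[OF Z(1) that] that dim by simp
  define a b c d where "a = Z $$ (0, 0)" "b = Z $$ (0, 1)" "c = Z $$ (1, 0)" "d = Z $$ (1, 1)"
  note defs = this
  have 00: "star a * a + star c * c = \<tau> e"
    using entry[of 0 0] by (simp add: Y_def defs star_zero star_identity[OF e(1)] is_identityD[OF e(1)])
  have 01: "star a * b + star c * d = \<tau> x"
    using entry[of 0 1] by (simp add: Y_def defs star_zero star_identity[OF e(1)] is_identityD[OF e(1)])
  have 10: "star b * a + star d * c = \<tau> (star x)"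
    using entry[of 1 0] by (simp add: Y_def defs star_zero is_identityD[OF e(1)])
  have 11: "star b * b + star d * d = \<tau> (star x * x)"
    using entry[of 1 1] by (simp add: Y_def defs star_zero)
  \<comment> \<open>The off-diagonal entries of \<open>star_mat Z * Z\<close> are adjoint to each
    other.\<close>
  show star: "\<tau> (star x) = star (\<tau> x)"
    by (simp add: 01[symmetric] 10[symmetric] star_add star_mult star_star)
  define t where "t = \<tau> x"
  \<comment> \<open>By \<open>01\<close>, \<open>t\<close> is the product of the adjoint of the
    first column of \<open>Z\<close> with the second; so \<open>p\<close>, \<open>q\<close> are the
    entries of the second column minus its projection onto the first.\<close>
  define p q where "p = b - a * t" "q = d - c * t"
  note pq = this
  have "star p * p + star q * q = (star b * b + star d * d) - (star b * a + star d * c) * t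
      - star t * (star a * b + star c * d) + star t * ((star a * a + star c * c) * t)"
    by (simp add: pq star_diff star_mult algebra_simps)
  also have "\<dots> = \<tau> (star x * x) - star (\<tau> x) * \<tau> x"
    unfolding 00 01 10 11 star by (simp add: t_def is_identityD[OF e(2)])
  finally show "\<tau> (star x * x) - star (\<tau> x) * \<tau> x \<in> sums_of_squares"
    by (metis sums_of_squares_add sums_of_squares_square)
qed

text \<open>By the Schwarz inequality, \<open>\<tau> (star y * y)\<close> is a square plus a sum of
  squares.\<close>

lemma completely_positive_sums_of_squares:
  assumes \<tau>: "completely_positive \<tau>" and e: "is_identity e" "is_identity (\<tau> e)"
    and "x \<in> sums_of_squares"
  shows "\<tau> x \<in> sums_of_squares"
proof -
  have lin: "Vector_Spaces.linear scaleC scaleC \<tau>"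
    using \<tau> by (simp add: completely_positive_def)
  show ?thesis
    using assms(4)
  proof induction
    case zero
    show ?case
      by (simp add: linear_simps[OF lin] sums_of_squares.zero)
  next
    case (step x y)
    have "\<tau> (star y * y) = (\<tau> (star y * y) - star (\<tau> y) * \<tau> y) + star (\<tau> y) * \<tau> y"
      by simp
    also have "\<dots> \<in> sums_of_squares"
      by (intro sums_of_squares.step completely_positive_schwarz[OF \<tau> e])
    finally show ?case
      using sums_of_squares_add step by (simp add: linear_simps[OF lin])
  qed
qed

section \<open>Powers of a unital completely positive map, measured by a faithful functional\<close>

locale unital_cp_map =
  fixes \<tau> :: "'a::cstar_algebra \<Rightarrow> 'a" and e :: 'a and g :: "'a \<Rightarrow> complex"
  assumes cp: "completely_positive \<tau>" and e: "is_identity e" and \<tau>_e: "\<tau> e = e"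
    and faithful: "faithful_positive g"
begin

lemma linear: "Vector_Spaces.linear scaleC scaleC \<tau>"
  using cp by (simp add: completely_positive_def)

lemma linear_g: "Vector_Spaces.linear scaleC (*) g"
  using faithful by (simp add: faithful_positive_def)

lemmas pow_simps = linear_simps[OF funpow_linear[OF linear]]
lemmas g_simps = linear_simps[OF linear_g]

lemma pos: "Im (g c) = 0" "Re (g c) \<ge> 0" if "c \<in> sums_of_squares"
  using faithful_positive_sums_of_squares[OF faithful that] by auto

lemma schwarz: "\<tau> (star x * x) - star (\<tau> x) * \<tau> x \<in> sums_of_squares"
  and map_star: "\<tau> (star x) = star (\<tau> x)"
  using completely_positive_schwarz[OF cp e] e by (simp_all add: \<tau>_e)

lemma pow_sums_of_squares: "c \<in> sums_of_squares \<Longrightarrow> (\<tau> ^^ n) c \<in> sums_of_squares"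
  by (induction n) (use completely_positive_sums_of_squares[OF cp e] e in \<open>simp_all add: \<tau>_e\<close>)

text \<open>Applying the positive map \<open>\<tau>\<close> to the inequality for \<open>n\<close>
  and adding the Schwarz inequality at \<open>(\<tau> ^^ n) x\<close> gives the next one.\<close>

lemma pow_schwarz:
  "(\<tau> ^^ n) (star x * x) - star ((\<tau> ^^ n) x) * (\<tau> ^^ n) x \<in> sums_of_squares"
proof (induction n)
  case 0
  show ?case
    by (simp add: sums_of_squares.zero)
next
  case (Suc n)
  let ?y = "(\<tau> ^^ n) x"
  have "\<tau> ((\<tau> ^^ n) (star x * x) - star ?y * ?y) \<in> sums_of_squares"
    using pow_sums_of_squares[OF Suc, of 1] by simp
  then have "\<tau> ((\<tau> ^^ n) (star x * x) - star ?y * ?y)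
      + (\<tau> (star ?y * ?y) - star (\<tau> ?y) * \<tau> ?y) \<in> sums_of_squares"
    by (intro sums_of_squares_add schwarz)
  then show ?case
    by (simp add: linear_simps[OF linear])
qed

text \<open>A bound \<open>star x * x \<le> R e\<close> is preserved by every power because
  \<open>\<tau>\<close> fixes \<open>e\<close>; hence \<open>C = R * Re (g e)\<close>.\<close>

lemma pow_bounded: "\<exists>C. \<forall>n. Re (g ((\<tau> ^^ n) (star x * x))) \<le> C"
proof -
  have "star (star x * x) = star x * x"
    by (simp add: star_mult star_star)
  then obtain R where R: "R *\<^sub>R e - star x * x \<in> sums_of_squares"
    using sums_of_squares_order_unit[OF e] by blast
  have "(\<tau> ^^ n) e = e" for n
    by (induction n) (simp_all add: \<tau>_e)
  then have "Re (g ((\<tau> ^^ n) (star x * x))) \<le> R * Re (g e)" for n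
    using pos(2)[OF pow_sums_of_squares[OF R, of n]]
    by (simp add: pow_simps g_simps scaleR_scaleC)
  then show ?thesis
    by blast
qed

text \<open>The squared norm of the GNS inner product \<open>g (star x * y)\<close>.\<close>

definition sqnorm :: "'a \<Rightarrow> real" where
  "sqnorm x = Re (g (star x * x))"

lemma sqnorm_nonneg: "sqnorm x \<ge> 0"
  using pos(2) sums_of_squares_square by (auto simp: sqnorm_def)

lemma sqnorm_eq_0: "sqnorm x = 0 \<Longrightarrow> x = 0"
  using faithful by (auto simp: sqnorm_def faithful_positive_def complex_eq_iff)

lemma sqnorm_scaleC: "sqnorm (c *\<^sub>C x) = (cmod c)\<^sup>2 * sqnorm x"
proof -
  have "star (c *\<^sub>C x) * (c *\<^sub>C x) = (complex_of_real ((cmod c)\<^sup>2)) *\<^sub>C (star x * x)"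
    unfolding complex_norm_square
    by (simp add: star_scaleC mult_scaleC_left mult_scaleC_right scaleC_scaleC mult.commute)
  then show ?thesis
    by (simp add: sqnorm_def g_simps del: of_real_power)
qed

text \<open>The parallelogram law, with one term dropped, stands in for the triangle
  inequality.\<close>

lemma sqnorm_diff_le: "sqnorm (x - y) \<le> 2 * sqnorm x + 2 * sqnorm y"
proof -
  have "star (x - y) * (x - y) + star (x + y) * (x + y)
      = (star x * x + star x * x) + (star y * y + star y * y)"
    by (simp add: star_diff star_add algebra_simps)
  from arg_cong[OF this, of g] have "sqnorm (x - y) + sqnorm (x + y) = 2 * sqnorm x + 2 * sqnorm y"
    unfolding sqnorm_def g_simps by (metis mult_2 plus_complex.simps(1))
  then show ?thesis
    using sqnorm_nonneg[of "x + y"] by simp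
qed

lemma sqnorm_pow_bounded: "\<exists>C. \<forall>n. sqnorm ((\<tau> ^^ n) x) \<le> C"
proof -
  have "sqnorm ((\<tau> ^^ n) x) \<le> Re (g ((\<tau> ^^ n) (star x * x)))" for n
    using pos(2)[OF pow_schwarz[of n x]] by (simp add: sqnorm_def g_simps)
  then show ?thesis
    using pow_bounded[of x] by (meson order_trans)
qed

end

subsection \<open>Unimodular spectrum\<close>

locale unimodular_unital_cp_map = unital_cp_map +
  assumes fin: "finite_dimensional TYPE('a)"
    and spectrum: "op_spectrum \<tau> \<subseteq> {z. cmod z = 1}"
begin

lemma eigenvalue_unimodular: "\<tau> v = z *\<^sub>C v \<Longrightarrow> v \<noteq> 0 \<Longrightarrow> cmod z = 1"
  using eigenvalue_in_op_spectrum[OF linear] spectrum by blast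

text \<open>A nontrivial Jordan block for a unimodular eigenvalue would make the powers unbounded.\<close>

lemma semisimple: "semisimple_op \<tau>"
  unfolding semisimple_op_def
proof (intro allI impI)
  fix z u v
  assume u: "\<tau> u - z *\<^sub>C u = v" and v: "\<tau> v = z *\<^sub>C v"
  show "v = 0"
  proof (rule ccontr)
    assume "v \<noteq> 0"
    then have z: "cmod z = 1"
      using eigenvalue_unimodular v by blast
    have \<tau>u: "\<tau> u = z *\<^sub>C u + v"
      using u by (simp add: algebra_simps)
    \<comment> \<open>This is \<open>\<tau>^n u = z^n u + n z^(n-1) v\<close> multiplied by
      \<open>z\<close>, which avoids the exponent \<open>n - 1\<close>.\<close>
    have pow: "z *\<^sub>C (\<tau> ^^ n) u = z ^ n *\<^sub>C (z *\<^sub>C u + of_nat n *\<^sub>C v)" for n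
    proof (induction n)
      case (Suc n)
      have "z *\<^sub>C (\<tau> ^^ Suc n) u = \<tau> (z *\<^sub>C (\<tau> ^^ n) u)"
        by (simp add: linear_simps[OF linear])
      also have "\<dots> = z ^ n *\<^sub>C (z *\<^sub>C (z *\<^sub>C u + v) + of_nat n *\<^sub>C z *\<^sub>C v)"
        unfolding Suc by (simp add: linear_simps[OF linear] \<tau>u v)
      also have "\<dots> = z ^ Suc n *\<^sub>C (z *\<^sub>C u + of_nat (Suc n) *\<^sub>C v)"
        by (simp add: scaleC_add_right scaleC_add_left scaleC_scaleC algebra_simps)
      finally show ?case .
    qed (simp add: scaleC_one)
    obtain C where C: "\<And>n. sqnorm ((\<tau> ^^ n) u) \<le> C"
      using sqnorm_pow_bounded by blast
    have bound: "real n * sqnorm v \<le> 2 * C + 2 * sqnorm u" for n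
    proof -
      have "sqnorm (z *\<^sub>C u + of_nat n *\<^sub>C v) = sqnorm ((\<tau> ^^ n) u)"
        using arg_cong[OF pow[of n], of sqnorm] z by (simp add: sqnorm_scaleC norm_power)
      then have "sqnorm (z *\<^sub>C u + of_nat n *\<^sub>C v) \<le> C"
        using C by simp
      then have "sqnorm (of_nat n *\<^sub>C v) \<le> 2 * C + 2 * sqnorm u"
        using sqnorm_diff_le[of "z *\<^sub>C u + of_nat n *\<^sub>C v" "z *\<^sub>C u"] z
        by (simp add: sqnorm_scaleC)
      \<comment> \<open>Weakening \<open>n^2\<close> to \<open>n\<close> leaves linear growth,
        enough for the Archimedean property.\<close>
      moreover have "real n * sqnorm v \<le> sqnorm (of_nat n *\<^sub>C v)"
        unfolding sqnorm_scaleC norm_of_nat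
        by (intro mult_right_mono sqnorm_nonneg) (cases n; simp add: power2_eq_square)
      ultimately show ?thesis
        by simp
    qed
    have "sqnorm v > 0"
      using sqnorm_eq_0[of v] sqnorm_nonneg[of v] \<open>v \<noteq> 0\<close> by force
    then obtain n where "2 * C + 2 * sqnorm u < real n * sqnorm v"
      using reals_Archimedean3 by blast
    with bound[of n] show False
      by simp
  qed
qed

lemma span_eigenvecs: "complex_vector.span (eigenvecs \<tau>) = UNIV"
  using semisimple_span_eigenvecs[OF fin linear semisimple] .

section \<open>The defect in the Schwarz inequality as a sesquilinear map\<close>

definition defect :: "'a \<Rightarrow> 'a \<Rightarrow> 'a" where
  "defect x y = \<tau> (star x * y) - star (\<tau> x) * \<tau> y"

lemma defect_linear_right: "defect x (c *\<^sub>C y + y') = c *\<^sub>C defect x y + defect x y'"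
  by (simp add: defect_def linear_simps[OF linear] distrib_left mult_scaleC_right
      complex_vector.scale_right_diff_distrib)

lemma defect_linear_left: "defect (c *\<^sub>C x + x') y = cnj c *\<^sub>C defect x y + defect x' y"
  by (simp add: defect_def linear_simps[OF linear] distrib_right mult_scaleC_left star_add
      star_scaleC complex_vector.scale_right_diff_distrib)

lemma defect_eigenvec:
  assumes "v \<in> eigenvecs \<tau>"
  shows "defect v v = 0"
proof (cases "v = 0")
  case True
  then show ?thesis
    by (simp add: defect_def linear_simps[OF linear])
next
  case False
  obtain z where z: "\<tau> v = z *\<^sub>C v"
    using assms by (auto simp: eigenvecs_def)
  then have "cmod z = 1"
    using eigenvalue_unimodular False by blast
  then have "cnj z * z = 1"
    by (metis complex_norm_square mult.commute of_real_1 power_one)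
  then have star_\<tau>: "star (\<tau> v) * \<tau> v = star v * v"
    by (simp add: z star_scaleC mult_scaleC_left mult_scaleC_right scaleC_scaleC scaleC_one
        mult.commute)
  have d: "defect v v \<in> sums_of_squares"
    unfolding defect_def by (rule schwarz)
  define a where "a n = Re (g ((\<tau> ^^ n) (star v * v)))" for n
  \<comment> \<open>Since \<open>|z| = 1\<close>, the defect at \<open>v\<close> equals
    \<open>\<tau> (star v * v) - star v * v\<close>, so the sequence telescopes; \<open>a\<close> is
    monotone and bounded, and its increments tend to 0.\<close>
  have incr: "Re (g ((\<tau> ^^ n) (defect v v))) = a (Suc n) - a n" for n
    by (simp add: defect_def star_\<tau> a_def pow_simps g_simps funpow_swap1)
  then have "a n \<le> a (Suc n)" for n
    using pos(2)[OF pow_sums_of_squares[OF d, of n]] by simp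
  then have "incseq a"
    by (rule incseq_SucI)
  moreover obtain C where "\<And>n. a n \<le> C"
    using pow_bounded[of v] by (auto simp: a_def)
  ultimately obtain L where L: "a \<longlonglongrightarrow> L"
    using incseq_convergent by blast
  have "(\<lambda>n. complex_of_real (a (Suc n) - a n)) \<longlonglongrightarrow> complex_of_real (L - L)"
    by (intro tendsto_of_real tendsto_diff LIMSEQ_Suc L)
  moreover have "complex_of_real (a (Suc n) - a n) = g ((\<tau> ^^ n) (defect v v))" for n
    using pos(1)[OF pow_sums_of_squares[OF d, of n]] incr[of n] by (simp add: complex_eq_iff)
  ultimately have lim: "(\<lambda>n. g ((\<tau> ^^ n) (defect v v))) \<longlonglongrightarrow> 0"
    by simp
  obtain zs where zs: "annihilates \<tau> zs (defect v v)"
    "\<forall>z\<in>set zs. \<exists>v. v \<noteq> 0 \<and> \<tau> v = z *\<^sub>C v"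
    using finite_dimensional_annihilates[OF fin linear] annihilates_eigenvalues[OF linear] by metis
  then have "\<forall>z\<in>set zs. cmod z = 1"
    using eigenvalue_unimodular by blast
  from annihilates_unimodular_tendsto_0[OF linear linear_g zs(1) this lim, of 0]
  have "g (defect v v) = 0"
    by simp
  then show ?thesis
    using faithful_positive_sums_of_squares[OF faithful d] by blast
qed

text \<open>At \<open>c *\<^sub>C v + w\<close> the diagonal terms vanish, so the cross terms alone
  are positive; replacing \<open>c\<close> by \<open>- c\<close> flips their sign, and they vanish
  by antisymmetry.\<close>

lemma defect_eigenvecs:
  assumes "v \<in> eigenvecs \<tau>" "w \<in> eigenvecs \<tau>"
  shows "defect v w = 0"
proof -
  have pos: "cnj c *\<^sub>C defect v w + c *\<^sub>C defect w v \<in> sums_of_squares" for c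
  proof -
    have "defect (c *\<^sub>C v + w) (c *\<^sub>C v + w) \<in> sums_of_squares"
      unfolding defect_def by (rule schwarz)
    then show ?thesis
      by (simp add: defect_linear_left defect_linear_right defect_eigenvec assms)
         (simp add: add.commute)
  qed
  have zero: "cnj c *\<^sub>C defect v w + c *\<^sub>C defect w v = 0" for c
    by (rule sums_of_squares_antisym[OF faithful pos]) (use pos[of "- c"] in simp)
  have "defect w v = - defect v w"
    using zero[of 1] by (simp add: scaleC_one eq_neg_iff_add_eq_0 add.commute)
  \<comment> \<open>Given the relation for \<open>c = 1\<close>, the choice \<open>c = \<i>\<close>
    leaves only a multiple of \<open>defect v w\<close>.\<close>
  then have "\<i> *\<^sub>C (defect v w + defect v w) = - (cnj \<i> *\<^sub>C defect v w + \<i> *\<^sub>C defect w v)"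
    by (simp add: scaleC_add_right)
  also have "\<dots> = 0"
    by (simp only: zero) simp
  finally have "2 *\<^sub>R defect v w = 0"
    by (simp add: scaleR_2)
  then show ?thesis
    by simp
qed

text \<open>Sesquilinearity extends the vanishing from eigenvectors to their span, one argument at a
  time.\<close>

lemma defect_eq_0: "defect x y = 0"
proof -
  have "y \<in> complex_vector.span (eigenvecs \<tau>)" "x \<in> complex_vector.span (eigenvecs \<tau>)"
    by (simp_all add: span_eigenvecs)
  then show ?thesis
  proof (induction y rule: complex_vector.span_induct_alt)
    case base
    show ?case
      by (simp add: defect_def linear_simps[OF linear])
  next
    case (step c w y)
    have "x' \<in> complex_vector.span (eigenvecs \<tau>) \<Longrightarrow> defect x' w = 0" for x'
    proof (induction rule: complex_vector.span_induct_alt)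
      case base
      show ?case
        by (simp add: defect_def linear_simps[OF linear] star_zero)
    qed (simp add: defect_linear_left defect_eigenvecs step.hyps)
    with step show ?case
      by (simp add: defect_linear_right)
  qed
qed

lemma star_automorphism: "star_automorphism \<tau>"
proof -
  have "0 \<notin> op_spectrum \<tau>"
    using spectrum by auto
  then have "bij \<tau>"
    by (simp add: op_spectrum_def)
  \<comment> \<open>Putting \<open>star x\<close> in the first slot cancels the adjoint in
    \<open>defect\<close>, as \<open>\<tau>\<close> commutes with \<open>star\<close>.\<close>
  moreover have "\<tau> (x * y) = \<tau> x * \<tau> y" for x y
    using defect_eq_0[of "star x" y] by (simp add: defect_def map_star star_star)
  ultimately show ?thesis
    unfolding star_automorphism_def using linear map_star by blast
qed

end

theorem mainTheorem4:
  fixes \<tau> :: "'a::cstar_algebra \<Rightarrow> 'a"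
  assumes "finite_dimensional TYPE('a)"
    and "unital_map \<tau>"
    and "completely_positive \<tau>"
    and "op_spectrum \<tau> \<subseteq> {z. cmod z = 1}"
  shows "star_automorphism \<tau>"
proof -
  obtain e where e: "is_identity e" "is_identity (\<tau> e)"
    using assms(2) by (auto simp: unital_map_def)
  obtain g :: "'a \<Rightarrow> complex" where "faithful_positive g"
    using exists_faithful_positive[OF assms(1) e(1)] by blast
  \<comment> \<open>Uniqueness of the identity turns the hypothesis on \<open>\<tau> e\<close> into
    \<open>\<tau> e = e\<close>.\<close>
  then interpret unimodular_unital_cp_map \<tau> e g
    using assms e is_identity_unique[OF e(2) e(1)] by unfold_locales auto
  show ?thesis
    by (rule star_automorphism)
qed

end
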